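(* Let $d\ge 2$ be an integer. Every $2d$-regular finite simple graph $G$ (not necessarily connected) admits an antimagic orientation.
   Context: For a digraph $D$ with arc set $A(D)$, an antimagic labeling of $D$ is a bijection $c:A(D)\to\{1,2,\dots,|A(D)|\}$ such that no two distinct vertices of $D$ have the same vertex-sum, where the vertex-sum of a vertex $u$ is the sum of the labels of all arcs entering $u$ minus the sum of the labels of all arcs leaving $u$. A digraph is antimagic if it has an antimagic labeling. A graph $G$ admits an antimagic orientation if some orientation of $G$ is antimagic. *)

theory Defs
  imports "Graph_Theory.Pair_Digraph"
begin

text \<open>
  A finite simple graph is a \<^locale>\<open>pair_graph\<close>: a finite, loop-free, symmetric digraph without
  parallel arcs, in which each edge is present as both of the arcs \<open>(u, v)\<close> and \<open>(v, u)\<close>.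
  Hence the number of edges at a vertex is its out-degree.
\<close>

definition regular :: "nat \<Rightarrow> 'a pair_pre_digraph \<Rightarrow> bool" where
  "regular k G \<longleftrightarrow> (\<forall>v \<in> pverts G. out_degree (with_proj G) v = k)"

definition orientation_of :: "'a pair_pre_digraph \<Rightarrow> 'a pair_pre_digraph \<Rightarrow> bool" where
  "orientation_of D G \<longleftrightarrow>
     pverts D = pverts G \<and> parcs D \<subseteq> parcs G \<and>
     (\<forall>(u, v) \<in> parcs G. ((u, v) \<in> parcs D) \<noteq> ((v, u) \<in> parcs D))"

definition vertex_sum :: "('a, 'b) pre_digraph \<Rightarrow> ('b \<Rightarrow> nat) \<Rightarrow> 'a \<Rightarrow> int" where
  "vertex_sum D c u = (\<Sum>e \<in> in_arcs D u. int (c e)) - (\<Sum>e \<in> out_arcs D u. int (c e))"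

definition antimagic_labeling :: "('a, 'b) pre_digraph \<Rightarrow> ('b \<Rightarrow> nat) \<Rightarrow> bool" where
  "antimagic_labeling D c \<longleftrightarrow>
     bij_betw c (arcs D) {1..card (arcs D)} \<and>
     (\<forall>u \<in> verts D. \<forall>v \<in> verts D. u \<noteq> v \<longrightarrow> vertex_sum D c u \<noteq> vertex_sum D c v)"

definition antimagic :: "('a, 'b) pre_digraph \<Rightarrow> bool" where
  "antimagic D \<longleftrightarrow> (\<exists>c. antimagic_labeling D c)"

definition admits_antimagic_orientation :: "'a pair_pre_digraph \<Rightarrow> bool" where
  "admits_antimagic_orientation G \<longleftrightarrow> (\<exists>D. orientation_of D G \<and> antimagic (with_proj D))"

end

theory Submission
  imports Defs "HOL-Library.Multiset"
begin

text \<open>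
  Consecutive labels along a directed walk contribute \<open>-1\<close> to every vertex each time the walk passes
  straight through it, so only the ends of walks matter. Every component has a closed Euler trail;
  cut it at a vertex \<open>w\<close> where it closes a cycle, into this cycle \<open>c1\<close> and a closed trail \<open>c2\<close>. As
  all degrees are at least 4, \<open>c2\<close> still visits every vertex. Reverse the direction of \<open>c2\<close> once at every
  vertex other than \<open>w\<close> and one further vertex \<open>x\<close> of \<open>c1\<close>, giving the segments between reversals
  increasing blocks of labels: the reversal vertices become sinks and sources of strictly growing
  weight. Stack the trails \<open>c2\<close> of all components, and put the cycles \<open>c1\<close> above them with the largest
  labels, each oriented from \<open>w\<close> to \<open>x\<close> along both of its arcs. Then each \<open>x\<close> outweighs all other sinks and
  each \<open>w\<close> all other sources; ordering the cycles by the weight of \<open>w\<close> in \<open>c2\<close> separates the vertices \<open>w\<close>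
  from each other.
\<close>

section \<open>Walks, edge multisets and the excess along a walk\<close>

fun walk_arcs :: "'a list \<Rightarrow> ('a \<times> 'a) list" where
  "walk_arcs (u # v # vs) = (u, v) # walk_arcs (v # vs)"
| "walk_arcs _ = []"

text \<open>Sets forget direction: two arc lists with the same \<open>mset (edges _)\<close> orient
  the same edges, possibly in other directions and in another order of labels.\<close>

definition edge_of :: "'a \<times> 'a \<Rightarrow> 'a set" where
  "edge_of a = {fst a, snd a}"

abbreviation edges :: "('a \<times> 'a) list \<Rightarrow> 'a set list" where
  "edges as \<equiv> map edge_of as"

text \<open>
  If the arcs of \<open>as\<close> get the labels \<open>k + 1, k + 2, \<dots>\<close>, this is twice the vertex-sum plus the degree:
  with this normalisation straight passes contribute 0.
\<close>

fun excess :: "nat \<Rightarrow> ('a \<times> 'a) list \<Rightarrow> 'a \<Rightarrow> int" where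
  "excess k [] u = 0"
| "excess k (a # as) u =
     (if snd a = u then 2 * int k + 3 else 0) - (if fst a = u then 2 * int k + 1 else 0)
     + excess (Suc k) as u"

lemma excess_append: "excess k (as @ bs) u = excess k as u + excess (k + length as) bs u"
  by (induction as arbitrary: k) auto

lemma length_walk_arcs [simp]: "length (walk_arcs vs) = length vs - 1"
  by (induction vs rule: walk_arcs.induct) auto

lemma walk_arcs_join:
  "walk_arcs (xs @ v # ys) = walk_arcs (xs @ [v]) @ walk_arcs (v # ys)"
proof (induction xs rule: walk_arcs.induct)
  case ("2_2" u)
  then show ?case by (cases ys) auto
qed auto

lemma edges_walk_arcs_rev: "edges (walk_arcs (rev vs)) = rev (edges (walk_arcs vs))"
proof (induction vs rule: walk_arcs.induct)
  case (1 u v vs)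
  have "walk_arcs (rev (u # v # vs)) = walk_arcs (rev vs @ v # [u])" by simp
  also have "\<dots> = walk_arcs (rev (v # vs)) @ [(v, u)]"
    by (subst walk_arcs_join) simp
  finally show ?case using 1 by (auto simp: edge_of_def)
qed auto

text \<open>At an inner vertex the entering arc with label \<open>j\<close> adds
  \<open>2 * j + 1\<close>, and the next arc, with label \<open>j + 1\<close>, subtracts
  \<open>2 * (j + 1) - 1\<close>, the same amount. Only the two ends survive; a closed walk keeps
  both terms at its one end.\<close>

lemma excess_walk:
  assumes "vs \<noteq> []"
  shows "excess k (walk_arcs vs) u =
    (if u = last vs then 2 * int (k + length vs) - 1 else 0) - (if u = hd vs then 2 * int k + 1 else 0)"
  using assms by (induction vs arbitrary: k rule: walk_arcs.induct) auto

section \<open>Reversing a trail at prescribed vertices\<close>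

text \<open>\<open>y\<close> is the member of \<open>Y\<close> whose first occurrence comes latest.
  Cutting there leaves a prefix that contains the rest of \<open>Y\<close> and meets
  \<open>y\<close> only at its end, as the induction in \<open>zigzag\<close> requires.\<close>

lemma last_first_occurrence:
  assumes "Y \<noteq> {}" "Y \<subseteq> set vs"
  obtains xs y zs where "vs = xs @ y # zs" "y \<in> Y" "y \<notin> set xs" "Y - {y} \<subseteq> set xs"
proof -
  have "\<exists>xs y zs. vs = xs @ y # zs \<and> y \<in> Y \<and> y \<notin> set xs \<and> Y - {y} \<subseteq> set xs"
    using assms
  proof (induction vs rule: rev_induct)
    case (snoc v vs)
    show ?case
    proof (cases "Y \<subseteq> set vs")
      case True
      with snoc obtain xs y zs where "vs = xs @ y # zs" "y \<in> Y" "y \<notin> set xs" "Y - {y} \<subseteq> set xs"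
        by blast
      then have "vs @ [v] = xs @ y # (zs @ [v])" by simp
      then show ?thesis using \<open>y \<in> Y\<close> \<open>y \<notin> set xs\<close> \<open>Y - {y} \<subseteq> set xs\<close> by blast
    next
      case False
      with snoc.prems have "v \<in> Y" "v \<notin> set vs" "Y - {v} \<subseteq> set vs" by auto
      then show ?thesis by blast
    qed
  qed auto
  then show thesis using that by blast
qed

text \<open>
  Here \<open>out\<close> says that the last segment leaves \<open>last vs\<close>, and \<open>p\<close> is the number of labels below that
  segment, which bounds the weight of the sources already created.
\<close>

lemma zigzag:
  assumes "finite Y" "length vs \<ge> 2" "Y \<subseteq> set vs" "hd vs \<notin> Y" "last vs \<notin> Y"
    and "K = k + (length vs - 1)"
  shows "\<exists>as \<alpha> \<beta> p. mset (edges as) = mset (edges (walk_arcs vs))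
    \<and> (\<forall>u. u \<notin> Y \<longrightarrow> excess k as u = (if u = hd vs then \<alpha> else 0) + (if u = last vs then \<beta> else 0))
    \<and> inj_on (excess k as) Y
    \<and> (\<forall>u\<in>Y. 4 * int k + 2 < \<bar>excess k as u\<bar> \<and> \<bar>excess k as u\<bar> \<le> 4 * int K + 2)
    \<and> \<alpha> \<le> 2 * int K + 1
    \<and> (if out then \<beta> = - (2 * int p + 1) \<and> k \<le> p \<and> p < K
                   \<and> (\<forall>u\<in>Y. excess k as u \<ge> - (4 * int p + 2)) \<and> (Y \<noteq> {} \<longrightarrow> \<alpha> \<le> 2 * int p + 1)
       else \<beta> = 2 * int K + 1)"
  using assms
proof (induction "card Y" arbitrary: Y vs out K)
  case 0
  then have Y: "Y = {}" and ne: "vs \<noteq> []" and K: "int (k + length vs) = int K + 1" "k < K" by auto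
  \<comment> \<open>The walk is a single segment. If \<open>out\<close>, it is traversed backwards
    and \<open>hd vs\<close> gets \<open>2 * K + 1\<close> while \<open>p = k\<close>; this is why
    the bound of \<alpha> by \<open>2 * p + 1\<close> is guarded by
    \<open>Y \<noteq> {}\<close>.\<close>
  show ?case
  proof (cases out)
    case True
    have e: "mset (edges (walk_arcs (rev vs))) = mset (edges (walk_arcs vs))"
      by (simp only: edges_walk_arcs_rev mset_rev)
    show ?thesis
      by (rule exI[of _ "walk_arcs (rev vs)"], rule exI[of _ "2 * int K + 1"],
          rule exI[of _ "- (2 * int k + 1)"], rule exI[of _ k])
        (use True Y ne K e in \<open>auto simp: excess_walk hd_rev last_rev\<close>)
  next
    case False
    show ?thesis
      by (rule exI[of _ "walk_arcs vs"], rule exI[of _ "- (2 * int k + 1)"],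
          rule exI[of _ "2 * int K + 1"], rule exI[of _ k])
        (use False Y ne K in \<open>auto simp: excess_walk\<close>)
  qed
next
  case (Suc n)
  then have "Y \<noteq> {}" by auto
  then obtain xs y zs where vs: "vs = xs @ y # zs" and y: "y \<in> Y" "y \<notin> set xs" "Y - {y} \<subseteq> set xs"
    using last_first_occurrence Suc.prems(3) by metis
  have xs: "xs \<noteq> []" and zs: "zs \<noteq> []" using Suc.prems y vs by auto
  define K' where "K' = k + length xs"
  have K: "K = K' + length zs" and "k < K'" "K' < K" using Suc.prems(6) vs xs zs by (auto simp: K'_def)
  have hd: "hd (xs @ [y]) = hd vs" and lst: "last (y # zs) = last vs" using vs xs zs by auto
  have ends: "hd vs \<noteq> y" "last vs \<noteq> y" using Suc.prems y by auto
  have IH_prems: "n = card (Y - {y})" "finite (Y - {y})" "2 \<le> length (xs @ [y])"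
    "Y - {y} \<subseteq> set (xs @ [y])" "hd (xs @ [y]) \<notin> Y - {y}" "last (xs @ [y]) \<notin> Y - {y}"
    "K' = k + (length (xs @ [y]) - 1)"
    using Suc.hyps(2) Suc.prems(1,4) xs y hd by (auto simp: K'_def Suc_le_eq)
  \<comment> \<open>The prefix is taken with the opposite direction flag, so that the two segments
    meeting at \<open>y\<close> both point to it (\<open>out\<close>, a sink) or both away from it
    (a source).\<close>
  obtain as \<alpha> \<beta> p where as: "mset (edges as) = mset (edges (walk_arcs (xs @ [y])))"
    and off: "\<forall>u. u \<notin> Y - {y} \<longrightarrow> excess k as u =
      (if u = hd (xs @ [y]) then \<alpha> else 0) + (if u = last (xs @ [y]) then \<beta> else 0)"
    and inj: "inj_on (excess k as) (Y - {y})"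
    and bd: "\<forall>u\<in>Y - {y}. 4 * int k + 2 < \<bar>excess k as u\<bar> \<and> \<bar>excess k as u\<bar> \<le> 4 * int K' + 2"
    and \<alpha>: "\<alpha> \<le> 2 * int K' + 1"
    and dir: "if \<not> out then \<beta> = - (2 * int p + 1) \<and> k \<le> p \<and> p < K'
                   \<and> (\<forall>u\<in>Y - {y}. excess k as u \<ge> - (4 * int p + 2)) \<and> (Y - {y} \<noteq> {} \<longrightarrow> \<alpha> \<le> 2 * int p + 1)
       else \<beta> = 2 * int K' + 1"
    using Suc.hyps(1)[OF IH_prems, of "\<not> out"] by (elim exE conjE) (rule that; assumption)
  have off: "excess k as u = (if u = hd vs then \<alpha> else 0) + (if u = y then \<beta> else 0)" if "u \<notin> Y - {y}" for u
    using off that hd by simp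
  have len: "k + length as = K'"
    using arg_cong[OF as, of size] by (simp add: K'_def)
  define seg where "seg = walk_arcs (if out then rev (y # zs) else y # zs)"
  have seg_edges: "mset (edges seg) = mset (edges (walk_arcs (y # zs)))"
    unfolding seg_def by (simp only: edges_walk_arcs_rev mset_rev split: if_splits) simp
  have seg: "excess K' seg u = (if out then (if u = y then 2 * int K + 1 else 0) - (if u = last vs then 2 * int K' + 1 else 0)
      else (if u = last vs then 2 * int K + 1 else 0) - (if u = y then 2 * int K' + 1 else 0))" for u
    unfolding seg_def using lst zs by (auto simp: excess_walk K hd_rev last_rev hd_append)
  have tot: "excess k (as @ seg) u = excess k as u + excess K' seg u" for u
    by (simp add: excess_append len)
  have old: "excess k (as @ seg) u = excess k as u" if "u \<in> Y - {y}" for u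
    using that Suc.prems(4,5) by (auto simp: tot seg)
  have new: "excess k (as @ seg) y = (if out then 2 * int K' + 2 * int K + 2 else - (2 * int p + 2 * int K' + 2))"
    using off[of y] dir ends by (auto simp: tot seg)
  show ?case
  proof (rule exI[of _ "as @ seg"], rule exI[of _ \<alpha>],
      rule exI[of _ "if out then - (2 * int K' + 1) else 2 * int K + 1"], rule exI[of _ K'], intro conjI)
    show "mset (edges (as @ seg)) = mset (edges (walk_arcs vs))"
      unfolding vs by (subst walk_arcs_join) (use as seg_edges in simp)
    show "\<forall>u. u \<notin> Y \<longrightarrow> excess k (as @ seg) u = (if u = hd vs then \<alpha> else 0)
        + (if u = last vs then if out then - (2 * int K' + 1) else 2 * int K + 1 else 0)"
      using y(1) by (auto simp: tot off seg)
    \<comment> \<open>A new sink has weight above \<open>4 * K' + 2\<close>, the bound for all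
      earlier weights. A new source only has weight \<open>2 * p + 2 * K' + 2\<close>, so it is
      compared with the finer bound \<open>4 * p + 2\<close> for the earlier sources, using
      \<open>p < K'\<close>.\<close>
    have "excess k (as @ seg) u \<noteq> excess k (as @ seg) y" if u: "u \<in> Y - {y}" for u
    proof (cases out)
      case True
      then show ?thesis using bspec[OF bd u] \<open>K' < K\<close> by (auto simp: old[OF u] new)
    next
      case False
      then have "excess k as u \<ge> - (4 * int p + 2)" "p < K'" using dir u by auto
      then show ?thesis using False by (auto simp: old[OF u] new)
    qed
    moreover have "inj_on (excess k (as @ seg)) (Y - {y})"
      using inj old by (auto simp: inj_on_def)
    ultimately show "inj_on (excess k (as @ seg)) Y"
      unfolding inj_on_def by (metis insertE insert_Diff y(1))
    have "4 * int k + 2 < \<bar>excess k (as @ seg) u\<bar> \<and> \<bar>excess k (as @ seg) u\<bar> \<le> 4 * int K + 2" if "u \<in> Y" for u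
    proof (cases "u = y")
      case True
      then show ?thesis using new dir \<open>k < K'\<close> \<open>K' < K\<close> by (auto split: if_splits)
    next
      case False
      then show ?thesis using bspec[OF bd, of u] old[of u] \<open>K' < K\<close> that by auto
    qed
    then show "\<forall>u\<in>Y. 4 * int k + 2 < \<bar>excess k (as @ seg) u\<bar> \<and> \<bar>excess k (as @ seg) u\<bar> \<le> 4 * int K + 2"
      by blast
    show "\<alpha> \<le> 2 * int K + 1" using \<alpha> \<open>K' < K\<close> by auto
    have "excess k (as @ seg) u \<ge> - (4 * int K' + 2)" if "u \<in> Y" out for u
    proof (cases "u = y")
      case False
      then show ?thesis using bspec[OF bd, of u] old[of u] that by auto
    qed (use that new in auto)
    then show "if out then (if out then - (2 * int K' + 1) else 2 * int K + 1) = - (2 * int K' + 1) \<and> k \<le> K' \<and> K' < K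
                   \<and> (\<forall>u\<in>Y. excess k (as @ seg) u \<ge> - (4 * int K' + 2)) \<and> (Y \<noteq> {} \<longrightarrow> \<alpha> \<le> 2 * int K' + 1)
       else (if out then - (2 * int K' + 1) else 2 * int K + 1) = 2 * int K + 1"
      using \<open>k < K'\<close> \<open>K' < K\<close> \<alpha> by auto
  qed
qed

text \<open>The last segment is made to leave \<open>w\<close>, so that \<beta> =
  \<open>- (2 * p + 1)\<close> outweighs \<alpha> at the common end. Since
  \<open>Y \<noteq> {}\<close>, \<alpha> is at most \<open>2 * p + 1\<close>, which gives the sign
  of the excess at \<open>w\<close>.\<close>

lemma closed_zigzag:
  assumes "finite Y" "Y \<noteq> {}" "Y \<subseteq> set vs" "length vs \<ge> 2" "hd vs = w" "last vs = w" "w \<notin> Y"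
  obtains as where "mset (edges as) = mset (edges (walk_arcs vs))"
    "\<And>u. u \<notin> insert w Y \<Longrightarrow> excess k as u = 0" "excess k as w \<le> 0" "inj_on (excess k as) Y"
    "\<And>u. u \<in> Y \<Longrightarrow> 4 * int k + 2 < \<bar>excess k as u\<bar> \<and> \<bar>excess k as u\<bar> \<le> 4 * int (k + length as) + 2"
proof -
  obtain as \<alpha> \<beta> p where as: "mset (edges as) = mset (edges (walk_arcs vs))"
    and off: "\<forall>u. u \<notin> Y \<longrightarrow> excess k as u = (if u = hd vs then \<alpha> else 0) + (if u = last vs then \<beta> else 0)"
    and inj: "inj_on (excess k as) Y"
    and bd: "\<forall>u\<in>Y. 4 * int k + 2 < \<bar>excess k as u\<bar> \<and> \<bar>excess k as u\<bar> \<le> 4 * int (k + (length vs - 1)) + 2"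
    and dir: "\<beta> = - (2 * int p + 1)" "\<alpha> \<le> 2 * int p + 1"
    using zigzag[of Y vs "k + (length vs - 1)" k True] assms by (simp only: if_True) blast
  have "length as = length vs - 1" using arg_cong[OF as, of size] by simp
  then show thesis using that[OF as] off inj bd dir assms by simp
qed

text \<open>Both parts of the closed walk run from \<open>w\<close> to \<open>x\<close>, the first
  with the lower labels. So \<open>w\<close> is charged for the first label of each part and
  \<open>x\<close> is credited with the last label of each; both weights fall into the same window
  as the weights in \<open>closed_zigzag\<close>.\<close>

lemma closed_single_turn:
  assumes "vs = xs @ x # zs" "xs \<noteq> []" "zs \<noteq> []" "hd vs = w" "last vs = w" "x \<noteq> w"
  obtains as where "mset (edges as) = mset (edges (walk_arcs vs))"
    "\<And>u. u \<notin> {w, x} \<Longrightarrow> excess k as u = 0"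
    "excess k as w < - (4 * int k + 2)" "- (4 * int (k + length as) + 2) \<le> excess k as w"
    "4 * int k + 2 < excess k as x" "excess k as x \<le> 4 * int (k + length as) + 2"
proof -
  define as where "as = walk_arcs (xs @ [x]) @ walk_arcs (rev (x # zs))"
  have "mset (edges as) = mset (edges (walk_arcs (xs @ [x]))) + mset (rev (edges (walk_arcs (x # zs))))"
    unfolding as_def by (simp only: edges_walk_arcs_rev map_append mset_append)
  also have "\<dots> = mset (edges (walk_arcs vs))"
    unfolding assms(1) by (subst walk_arcs_join) simp
  finally have e: "mset (edges as) = mset (edges (walk_arcs vs))" .
  have h: "hd (xs @ [x]) = w" "hd (rev (x # zs)) = w" using assms by (auto simp: hd_rev hd_append)
  have H: "excess k as u = (if u = x then 4 * int k + 4 * int (length xs) + 2 * int (length zs) + 2 else 0)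
     - (if u = w then 4 * int k + 2 * int (length xs) + 2 else 0)" for u
    unfolding as_def excess_append using h assms(6) by (subst (1 2) excess_walk) (auto simp: last_rev)
  have "length as = length xs + length zs" by (simp add: as_def)
  then show thesis
    by (intro that[OF e]) (use assms(2,3,6) in \<open>auto simp: H add_pos_pos\<close>)
qed

section \<open>Stacking the blocks of labels of several trails\<close>

text \<open>A trail that uses the labels from \<open>k + 1\<close> to \<open>k'\<close> puts the
  absolute excesses of its reversal vertices above \<open>4 * k + 2\<close> and not above
  \<open>4 * k' + 2\<close>. Successive blocks give disjoint windows, so injectivity is inherited
  from the single trails.\<close>

lemma stack_zigzags:
  assumes "distinct Ps"
    and "\<forall>P\<in>set Ps. length (B P) \<ge> 2 \<and> hd (B P) = W P \<and> last (B P) = W P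
      \<and> finite (Y P) \<and> Y P \<noteq> {} \<and> Y P \<subseteq> set (B P) \<and> W P \<notin> Y P"
    and "\<forall>P\<in>set Ps. \<forall>Q\<in>set Ps. P \<noteq> Q \<longrightarrow> insert (W P) (Y P) \<inter> insert (W Q) (Y Q) = {}"
  shows "\<exists>as. mset (edges as) = (\<Sum>P\<in>#mset Ps. mset (edges (walk_arcs (B P))))
    \<and> inj_on (excess k as) (\<Union>P\<in>set Ps. Y P)
    \<and> (\<forall>u\<in>(\<Union>P\<in>set Ps. Y P). 4 * int k + 2 < \<bar>excess k as u\<bar>
          \<and> \<bar>excess k as u\<bar> \<le> 4 * int (k + length as) + 2)
    \<and> (\<forall>P\<in>set Ps. excess k as (W P) \<le> 0)
    \<and> (\<forall>u. u \<notin> (\<Union>P\<in>set Ps. insert (W P) (Y P)) \<longrightarrow> excess k as u = 0)"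
  using assms
proof (induction Ps arbitrary: k)
  case Nil
  show ?case by (rule exI[of _ "[]"]) simp
next
  case (Cons P Ps)
  obtain as where as: "mset (edges as) = mset (edges (walk_arcs (B P)))"
    "\<And>u. u \<notin> insert (W P) (Y P) \<Longrightarrow> excess k as u = 0" "excess k as (W P) \<le> 0"
    "inj_on (excess k as) (Y P)"
    "\<And>u. u \<in> Y P \<Longrightarrow> 4 * int k + 2 < \<bar>excess k as u\<bar> \<and> \<bar>excess k as u\<bar> \<le> 4 * int (k + length as) + 2"
    using closed_zigzag[of "Y P" "B P" "W P" k] Cons.prems(2) by auto
  let ?k = "k + length as"
  have "distinct Ps" using Cons.prems(1) by simp
  moreover have "\<forall>P\<in>set Ps. length (B P) \<ge> 2 \<and> hd (B P) = W P \<and> last (B P) = W P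
      \<and> finite (Y P) \<and> Y P \<noteq> {} \<and> Y P \<subseteq> set (B P) \<and> W P \<notin> Y P"
    using Cons.prems(2) by simp
  moreover have "\<forall>P\<in>set Ps. \<forall>Q\<in>set Ps. P \<noteq> Q \<longrightarrow> insert (W P) (Y P) \<inter> insert (W Q) (Y Q) = {}"
    using Cons.prems(3) by (meson list.set_intros(2))
  ultimately obtain bs where bs: "mset (edges bs) = (\<Sum>P\<in>#mset Ps. mset (edges (walk_arcs (B P))))"
    "inj_on (excess ?k bs) (\<Union>P\<in>set Ps. Y P)"
    "\<forall>u\<in>(\<Union>P\<in>set Ps. Y P). 4 * int ?k + 2 < \<bar>excess ?k bs u\<bar>
          \<and> \<bar>excess ?k bs u\<bar> \<le> 4 * int (?k + length bs) + 2"
    "\<forall>P\<in>set Ps. excess ?k bs (W P) \<le> 0"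
    "\<forall>u. u \<notin> (\<Union>P\<in>set Ps. insert (W P) (Y P)) \<longrightarrow> excess ?k bs u = 0"
    using Cons.IH[of ?k] by blast
  have disj: "insert (W P) (Y P) \<inter> (\<Union>Q\<in>set Ps. insert (W Q) (Y Q)) = {}"
  proof -
    have "insert (W P) (Y P) \<inter> insert (W Q) (Y Q) = {}" if "Q \<in> set Ps" for Q
    proof -
      have "P \<noteq> Q" using Cons.prems(1) that by auto
      then show ?thesis using Cons.prems(3) that by (meson list.set_intros)
    qed
    then show ?thesis by blast
  qed
  \<comment> \<open>A trail contributes 0 away from its own \<open>W\<close> and \<open>Y\<close>,
    and these sets are disjoint for different trails; so every vertex keeps the excess from its own
    trail.\<close>
  have l: "excess k (as @ bs) u = excess k as u" if "u \<in> insert (W P) (Y P)" for u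
    using that disj bs(5) by (subst excess_append) auto
  have r: "excess k (as @ bs) u = excess ?k bs u" if "u \<notin> insert (W P) (Y P)" for u
    using as(2)[OF that] by (simp add: excess_append)
  have r': "excess k (as @ bs) u = excess ?k bs u" if "u \<in> (\<Union>Q\<in>set Ps. insert (W Q) (Y Q))" for u
    using that disj by (intro r) blast
  show ?case
  proof (rule exI[of _ "as @ bs"], intro conjI)
    show "mset (edges (as @ bs)) = (\<Sum>P\<in>#mset (P # Ps). mset (edges (walk_arcs (B P))))"
      using as(1) bs(1) by simp
    have Yl: "\<bar>excess k (as @ bs) u\<bar> > 4 * int k + 2 \<and> \<bar>excess k (as @ bs) u\<bar> \<le> 4 * int ?k + 2" if "u \<in> Y P" for u
      using as(5)[OF that] l that by simp
    have Yr: "\<bar>excess k (as @ bs) u\<bar> > 4 * int ?k + 2 \<and> \<bar>excess k (as @ bs) u\<bar> \<le> 4 * int (?k + length bs) + 2"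
      if "u \<in> (\<Union>Q\<in>set Ps. Y Q)" for u
    proof -
      have "u \<in> (\<Union>Q\<in>set Ps. insert (W Q) (Y Q))" using that by blast
      then show ?thesis using bs(3) r'[of u] that by metis
    qed
    show "inj_on (excess k (as @ bs)) (\<Union>P\<in>set (P # Ps). Y P)"
    proof (rule inj_onI)
      fix u v assume uv: "u \<in> (\<Union>P\<in>set (P # Ps). Y P)" "v \<in> (\<Union>P\<in>set (P # Ps). Y P)"
        "excess k (as @ bs) u = excess k (as @ bs) v"
      then consider "u \<in> Y P" "v \<in> Y P" | "u \<in> Y P" "v \<in> (\<Union>Q\<in>set Ps. Y Q)"
        | "v \<in> Y P" "u \<in> (\<Union>Q\<in>set Ps. Y Q)" | "u \<in> (\<Union>Q\<in>set Ps. Y Q)" "v \<in> (\<Union>Q\<in>set Ps. Y Q)"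
        by auto
      then show "u = v"
      proof cases
        case 1
        then show ?thesis using uv(3) as(4) l by (auto dest: inj_onD)
      next
        case 2
        then show ?thesis using uv(3) Yl[of u] Yr[of v] by simp
      next
        case 3
        then show ?thesis using uv(3) Yl[of v] Yr[of u] by simp
      next
        case 4
        then have "u \<in> (\<Union>Q\<in>set Ps. insert (W Q) (Y Q))" "v \<in> (\<Union>Q\<in>set Ps. insert (W Q) (Y Q))" by blast+
        then have "excess ?k bs u = excess ?k bs v" using uv(3) r'[of u] r'[of v] by metis
        then show ?thesis using 4 bs(2) by (auto dest: inj_onD)
      qed
    qed
    show "\<forall>u\<in>(\<Union>P\<in>set (P # Ps). Y P). 4 * int k + 2 < \<bar>excess k (as @ bs) u\<bar>
          \<and> \<bar>excess k (as @ bs) u\<bar> \<le> 4 * int (k + length (as @ bs)) + 2"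
      using Yl Yr by fastforce
    show "\<forall>P\<in>set (P # Ps). excess k (as @ bs) (W P) \<le> 0"
    proof
      fix Q assume "Q \<in> set (P # Ps)"
      then consider "Q = P" | "Q \<in> set Ps" by auto
      then show "excess k (as @ bs) (W Q) \<le> 0"
      proof cases
        case 1
        then show ?thesis using as(3) l[of "W P"] by simp
      next
        case 2
        then have "W Q \<in> (\<Union>Q\<in>set Ps. insert (W Q) (Y Q))" by blast
        then show ?thesis using bs(4) 2 r'[of "W Q"] by simp
      qed
    qed
    show "\<forall>u. u \<notin> (\<Union>P\<in>set (P # Ps). insert (W P) (Y P)) \<longrightarrow> excess k (as @ bs) u = 0"
      using bs(5) r by auto
  qed
qed

text \<open>The same windows, now with known signs: later cycles have larger labels, so along the
  list the sinks \<open>X P\<close> rise and the sources \<open>W P\<close> fall. The order of the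
  list is left to the caller, who uses it to separate the sources.\<close>

lemma stack_single_turns:
  assumes "distinct Ps"
    and "\<forall>P\<in>set Ps. hd (A P) = W P \<and> last (A P) = W P \<and> X P \<noteq> W P
      \<and> (\<exists>xs zs. A P = xs @ X P # zs \<and> xs \<noteq> [] \<and> zs \<noteq> [])"
    and "\<forall>P\<in>set Ps. \<forall>Q\<in>set Ps. P \<noteq> Q \<longrightarrow> {W P, X P} \<inter> {W Q, X Q} = {}"
  shows "\<exists>as. mset (edges as) = (\<Sum>P\<in>#mset Ps. mset (edges (walk_arcs (A P))))
    \<and> sorted_wrt (\<lambda>P Q. excess k as (X P) < excess k as (X Q)) Ps
    \<and> sorted_wrt (\<lambda>P Q. excess k as (W P) > excess k as (W Q)) Ps
    \<and> (\<forall>P\<in>set Ps. excess k as (X P) > 4 * int k + 2 \<and> excess k as (W P) < - (4 * int k + 2))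
    \<and> (\<forall>u. u \<notin> (\<Union>P\<in>set Ps. {W P, X P}) \<longrightarrow> excess k as u = 0)"
  using assms
proof (induction Ps arbitrary: k)
  case Nil
  show ?case by (rule exI[of _ "[]"]) simp
next
  case (Cons P Ps)
  obtain xs zs where "A P = xs @ X P # zs" "xs \<noteq> []" "zs \<noteq> []" "hd (A P) = W P" "last (A P) = W P" "X P \<noteq> W P"
    using Cons.prems(2) by auto
  then obtain as where as: "mset (edges as) = mset (edges (walk_arcs (A P)))"
    "\<And>u. u \<notin> {W P, X P} \<Longrightarrow> excess k as u = 0"
    "excess k as (W P) < - (4 * int k + 2)" "- (4 * int (k + length as) + 2) \<le> excess k as (W P)"
    "4 * int k + 2 < excess k as (X P)" "excess k as (X P) \<le> 4 * int (k + length as) + 2"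
    using closed_single_turn[of "A P" xs "X P" zs "W P" k] by blast
  let ?k = "k + length as"
  have "distinct Ps" using Cons.prems(1) by simp
  moreover have "\<forall>P\<in>set Ps. hd (A P) = W P \<and> last (A P) = W P \<and> X P \<noteq> W P
      \<and> (\<exists>xs zs. A P = xs @ X P # zs \<and> xs \<noteq> [] \<and> zs \<noteq> [])"
    using Cons.prems(2) by simp
  moreover have "\<forall>P\<in>set Ps. \<forall>Q\<in>set Ps. P \<noteq> Q \<longrightarrow> {W P, X P} \<inter> {W Q, X Q} = {}"
    using Cons.prems(3) by (meson list.set_intros(2))
  ultimately obtain bs where bs: "mset (edges bs) = (\<Sum>P\<in>#mset Ps. mset (edges (walk_arcs (A P))))"
    "sorted_wrt (\<lambda>P Q. excess ?k bs (X P) < excess ?k bs (X Q)) Ps"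
    "sorted_wrt (\<lambda>P Q. excess ?k bs (W P) > excess ?k bs (W Q)) Ps"
    "\<forall>P\<in>set Ps. excess ?k bs (X P) > 4 * int ?k + 2 \<and> excess ?k bs (W P) < - (4 * int ?k + 2)"
    "\<forall>u. u \<notin> (\<Union>P\<in>set Ps. {W P, X P}) \<longrightarrow> excess ?k bs u = 0"
    using Cons.IH[of ?k] by blast
  have disj: "{W P, X P} \<inter> {W Q, X Q} = {}" if "Q \<in> set Ps" for Q
  proof -
    have "P \<noteq> Q" using Cons.prems(1) that by auto
    then show ?thesis using Cons.prems(3) that by (meson list.set_intros)
  qed
  have l: "excess k (as @ bs) (W P) = excess k as (W P)" "excess k (as @ bs) (X P) = excess k as (X P)"
  proof -
    have "W P \<notin> (\<Union>Q\<in>set Ps. {W Q, X Q})" "X P \<notin> (\<Union>Q\<in>set Ps. {W Q, X Q})"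
      using disj by blast+
    then show "excess k (as @ bs) (W P) = excess k as (W P)" "excess k (as @ bs) (X P) = excess k as (X P)"
      using bs(5) by (metis add.right_neutral excess_append)+
  qed
  have r: "excess k (as @ bs) u = excess ?k bs u" if "u \<notin> {W P, X P}" for u
    using as(2)[OF that] by (simp add: excess_append)
  have r': "excess k (as @ bs) (W Q) = excess ?k bs (W Q)" "excess k (as @ bs) (X Q) = excess ?k bs (X Q)"
    if "Q \<in> set Ps" for Q
    using disj[OF that] by (auto intro!: r)
  show ?case
  proof (rule exI[of _ "as @ bs"], intro conjI)
    show "mset (edges (as @ bs)) = (\<Sum>P\<in>#mset (P # Ps). mset (edges (walk_arcs (A P))))"
      using as(1) bs(1) by simp
    have "sorted_wrt (\<lambda>P Q. excess k (as @ bs) (X P) < excess k (as @ bs) (X Q)) Ps"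
      by (rule sorted_wrt_mono_rel[OF _ bs(2)]) (simp add: r')
    then show "sorted_wrt (\<lambda>P Q. excess k (as @ bs) (X P) < excess k (as @ bs) (X Q)) (P # Ps)"
      using as(6) bs(4) by (fastforce simp: l r')
    have "sorted_wrt (\<lambda>P Q. excess k (as @ bs) (W P) > excess k (as @ bs) (W Q)) Ps"
      by (rule sorted_wrt_mono_rel[OF _ bs(3)]) (simp add: r')
    then show "sorted_wrt (\<lambda>P Q. excess k (as @ bs) (W P) > excess k (as @ bs) (W Q)) (P # Ps)"
      using as(4) bs(4) by (fastforce simp: l r')
    show "\<forall>P\<in>set (P # Ps). excess k (as @ bs) (X P) > 4 * int k + 2 \<and> excess k (as @ bs) (W P) < - (4 * int k + 2)"
      using as(3,5) bs(4) by (fastforce simp: l r')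
    show "\<forall>u. u \<notin> (\<Union>P\<in>set (P # Ps). {W P, X P}) \<longrightarrow> excess k (as @ bs) u = 0"
      using bs(5) r by auto
  qed
qed

section \<open>Decomposing an even graph into closed trails\<close>

text \<open>Every occurrence of \<open>u\<close> except a final one starts an arc, and every one
  except an initial one ends an arc. As edges have two distinct ends, no edge is counted
  twice.\<close>

lemma degree_walk:
  assumes "\<forall>e\<in>set (edges (walk_arcs vs)). card e = 2"
  shows "length (filter (\<lambda>e. u \<in> e) (edges (walk_arcs vs))) = count_list (butlast vs) u + count_list (tl vs) u"
  using assms by (induction vs rule: walk_arcs.induct) (auto simp: edge_of_def card_2_iff split: if_splits)

lemma count_list_butlast_tl:
  assumes "vs \<noteq> []"
  shows "count_list (butlast vs) u + (if u = last vs then 1 else 0) = count_list vs u"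
    and "count_list (tl vs) u + (if u = hd vs then 1 else 0) = count_list vs u"
proof -
  have "count_list (butlast vs @ [last vs]) u = count_list (butlast vs) u + (if u = last vs then 1 else 0)"
    by simp
  then show "count_list (butlast vs) u + (if u = last vs then 1 else 0) = count_list vs u"
    using assms by simp
  show "count_list (tl vs) u + (if u = hd vs then 1 else 0) = count_list vs u"
    using assms by (cases vs) auto
qed

text \<open>\<open>tl\<close> removes the vertex at which the two pieces are glued; for
  \<open>xs = []\<close> it leaves nothing to append. The first fact keeps the two pieces apart for
  use in \<open>split_closed_trail\<close>.\<close>

lemma rotate_closed_walk:
  assumes "hd vs = last vs" "vs = xs @ v # zs" "qs = (v # zs) @ tl (xs @ [v])"
  shows "mset (edges (walk_arcs qs)) = mset (edges (walk_arcs (v # zs))) + mset (edges (walk_arcs (xs @ [v])))"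
    and "mset (edges (walk_arcs qs)) = mset (edges (walk_arcs vs))"
    and "hd qs = v" "last qs = v" "length qs = length vs"
proof -
  show e: "mset (edges (walk_arcs qs)) = mset (edges (walk_arcs (v # zs))) + mset (edges (walk_arcs (xs @ [v])))"
  proof (cases xs)
    case (Cons h t)
    then have "h = last (v # zs)" using assms(1,2) by simp
    then have vz: "v # zs = butlast (v # zs) @ [h]"
      by (metis append_butlast_last_id list.distinct(1))
    have "qs = butlast (v # zs) @ h # (t @ [v])"
      using vz assms(3) Cons by (metis append.assoc append_Cons append_Nil list.sel(3))
    then have "walk_arcs qs = walk_arcs (butlast (v # zs) @ [h]) @ walk_arcs (h # t @ [v])"
      by (metis walk_arcs_join)
    then show ?thesis using vz Cons by simp
  qed (use assms in simp)
  then show "mset (edges (walk_arcs qs)) = mset (edges (walk_arcs vs))"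
    unfolding assms(2) by (subst walk_arcs_join) simp
  show "hd qs = v" using assms by simp
  show "last qs = v" using assms by (cases xs) auto
  show "length qs = length vs" using assms by (cases xs) auto
qed

lemma mem_walk_imp_edge:
  assumes "length vs \<ge> 2" "v \<in> set vs"
  shows "\<exists>e\<in>set (edges (walk_arcs vs)). v \<in> e"
  using assms
proof (induction vs rule: walk_arcs.induct)
  case (1 a b vs)
  then show ?case by (cases vs) (auto simp: edge_of_def)
qed auto

lemma edge_subset_walk: "e \<in> set (edges (walk_arcs vs)) \<Longrightarrow> e \<subseteq> set vs"
  by (induction vs rule: walk_arcs.induct) (auto simp: edge_of_def)

text \<open>A longest trail works. It uses all edges at its last vertex, and parity forces it to be
  closed. Then it can be rotated to end at any of its vertices, remaining longest, so it uses all
  edges there as well.\<close>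

lemma maximal_closed_trail:
  assumes fin: "finite E" and two: "\<forall>e\<in>E. card e = 2" and ev: "\<forall>v. even (card {e \<in> E. v \<in> e})" and "E \<noteq> {}"
  obtains P where "length P \<ge> 2" "hd P = last P" "distinct (edges (walk_arcs P))"
    "set (edges (walk_arcs P)) \<subseteq> E"
    "\<forall>v\<in>set P. \<forall>e\<in>E. v \<in> e \<longrightarrow> e \<in> set (edges (walk_arcs P))"
proof -
  define trail where "trail P \<longleftrightarrow> P \<noteq> [] \<and> distinct (edges (walk_arcs P)) \<and> set (edges (walk_arcs P)) \<subseteq> E" for P
  have bound: "length P < card E + 2" if "trail P" for P
  proof -
    have "length (edges (walk_arcs P)) \<le> card E"
      using that fin unfolding trail_def by (metis card_mono distinct_card)
    then show ?thesis by simp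
  qed
  obtain e0 where "e0 \<in> E" using \<open>E \<noteq> {}\<close> by blast
  then obtain a b where ab: "{a, b} \<in> E" "a \<noteq> b" using two by (metis card_2_iff)
  then have "trail [a, b]" by (simp add: trail_def edge_of_def)
  then obtain P where P: "trail P" and max: "\<And>Q. trail Q \<Longrightarrow> length Q \<le> length P"
    using ex_has_greatest_nat[of trail "[a, b]" length "card E + 2"] bound by (metis less_imp_le)
  have len: "length P \<ge> 2" using max[OF \<open>trail [a, b]\<close>] by simp
  \<comment> \<open>Stated for every trail of maximal length, so that it applies to the rotations of
    \<open>P\<close> too.\<close>
  have extend: "e \<in> set (edges (walk_arcs Q))"
    if Q: "trail Q" "length Q = length P" and e: "e \<in> E" "last Q \<in> e" for Q e
  proof (rule ccontr)
    assume new: "e \<notin> set (edges (walk_arcs Q))"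
    obtain v where v: "e = {last Q, v}" using two e by (metis card_2_iff insert_iff singletonD doubleton_eq_iff)
    have ne: "Q \<noteq> []" using Q by (simp add: trail_def)
    have "walk_arcs (Q @ [v]) = walk_arcs (butlast Q @ last Q # [v])"
      using ne by (metis append.assoc append_Cons append_Nil append_butlast_last_id)
    also have "\<dots> = walk_arcs Q @ [(last Q, v)]"
      using ne by (subst walk_arcs_join) simp
    finally have "trail (Q @ [v])" using Q new e(1) v by (auto simp: trail_def edge_of_def)
    then show False using max[of "Q @ [v]"] Q by simp
  qed
  have ne: "P \<noteq> []" and dist: "distinct (edges (walk_arcs P))" and sub: "set (edges (walk_arcs P)) \<subseteq> E"
    using P by (auto simp: trail_def)
  have closed: "hd P = last P"
  proof (rule ccontr)
    assume h: "hd P \<noteq> last P"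
    have "{e \<in> E. last P \<in> e} = {e. last P \<in> e} \<inter> set (edges (walk_arcs P))"
      using extend[OF P] sub by auto
    then have "card {e \<in> E. last P \<in> e} = length (filter (\<lambda>e. last P \<in> e) (edges (walk_arcs P)))"
      using distinct_length_filter[OF dist] by simp
    also have "\<dots> = count_list (butlast P) (last P) + count_list (tl P) (last P)"
      by (rule degree_walk) (use sub two in blast)
    \<comment> \<open>Of the occurrences of \<open>last P\<close>, \<open>butlast P\<close> lacks
      one and, for an open trail, \<open>tl P\<close> lacks none: the degree would be odd.\<close>
    finally have "card {e \<in> E. last P \<in> e} + 1 = 2 * count_list P (last P)"
      using count_list_butlast_tl[OF ne, of "last P"] h by simp
    then show False using ev[rule_format, of "last P"] by presburger
  qed
  have "e \<in> set (edges (walk_arcs P))" if v: "v \<in> set P" and e: "e \<in> E" "v \<in> e" for v e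
  proof -
    obtain xs zs where s: "P = xs @ v # zs" using v by (meson split_list)
    define Q where "Q = (v # zs) @ tl (xs @ [v])"
    note rot = rotate_closed_walk[OF closed s Q_def]
    have "set (edges (walk_arcs Q)) = set (edges (walk_arcs P))" "distinct (edges (walk_arcs Q))"
      using rot(2) dist by (metis mset_eq_setD, metis mset_eq_imp_distinct_iff)
    moreover have "Q \<noteq> []" by (simp add: Q_def)
    ultimately show ?thesis using extend[of Q e] rot(4,5) e sub by (simp add: trail_def)
  qed
  then show thesis using that len closed dist sub by blast
qed

text \<open>Removing a trail from \<open>maximal_closed_trail\<close> removes all edges at its
  vertices. The remaining degrees are 0 on the trail and unchanged off it, so parity survives and
  the later trails avoid its vertices.\<close>

lemma closed_trail_decomposition:
  assumes "finite E" "\<forall>e\<in>E. card e = 2" "\<forall>v. even (card {e \<in> E. v \<in> e})"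
  shows "\<exists>Ps. distinct Ps \<and> (\<forall>P\<in>set Ps. \<forall>Q\<in>set Ps. P \<noteq> Q \<longrightarrow> set P \<inter> set Q = {})
    \<and> (\<Sum>P\<in>#mset Ps. mset (edges (walk_arcs P))) = mset_set E
    \<and> (\<forall>P\<in>set Ps. length P \<ge> 2 \<and> hd P = last P \<and> distinct (edges (walk_arcs P))
        \<and> set (edges (walk_arcs P)) \<subseteq> E
        \<and> (\<forall>v\<in>set P. \<forall>e\<in>E. v \<in> e \<longrightarrow> e \<in> set (edges (walk_arcs P))))"
  using assms
proof (induction E rule: finite_psubset_induct)
  case (psubset E)
  show ?case
  proof (cases "E = {}")
    case True
    then show ?thesis by (intro exI[of _ "[]"]) simp
  next
    case False
    then obtain P where P: "length P \<ge> 2" "hd P = last P" "distinct (edges (walk_arcs P))"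
      "set (edges (walk_arcs P)) \<subseteq> E"
      "\<forall>v\<in>set P. \<forall>e\<in>E. v \<in> e \<longrightarrow> e \<in> set (edges (walk_arcs P))"
      by (rule maximal_closed_trail[OF psubset.hyps(1) psubset.prems])
    define F where "F = E - set (edges (walk_arcs P))"
    have ne: "P \<noteq> []" using P(1) by auto
    have "edges (walk_arcs P) \<noteq> []" using P(1) mem_walk_imp_edge[of P "hd P"] ne by force
    then have "F \<subset> E" using P(4) list.set_sel(1)[of "edges (walk_arcs P)"] unfolding F_def by blast
    have no_P: "v \<notin> e" if "e \<in> F" "v \<in> set P" for e v
      using P(5) that unfolding F_def by blast
    have "even (card {e \<in> F. v \<in> e})" for v
    proof (cases "v \<in> set P")
      case True
      then show ?thesis using no_P by (metis (mono_tags, lifting) card.empty empty_Collect_eq even_zero)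
    next
      case False
      then have "{e \<in> F. v \<in> e} = {e \<in> E. v \<in> e}"
        using edge_subset_walk unfolding F_def by blast
      then show ?thesis using psubset.prems(2) by simp
    qed
    moreover have "\<forall>e\<in>F. card e = 2" using psubset.prems(1) by (simp add: F_def)
    ultimately obtain Ps where Ps: "distinct Ps" "\<forall>P\<in>set Ps. \<forall>Q\<in>set Ps. P \<noteq> Q \<longrightarrow> set P \<inter> set Q = {}"
      "(\<Sum>P\<in>#mset Ps. mset (edges (walk_arcs P))) = mset_set F"
      "\<forall>P\<in>set Ps. length P \<ge> 2 \<and> hd P = last P \<and> distinct (edges (walk_arcs P))
        \<and> set (edges (walk_arcs P)) \<subseteq> F
        \<and> (\<forall>v\<in>set P. \<forall>e\<in>F. v \<in> e \<longrightarrow> e \<in> set (edges (walk_arcs P)))"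
      using psubset.IH[OF \<open>F \<subset> E\<close>] by blast
    have disj: "set P \<inter> set Q = {}" if "Q \<in> set Ps" for Q
    proof -
      have "length Q \<ge> 2" "set (edges (walk_arcs Q)) \<subseteq> F" using Ps(4) that by blast+
      then show ?thesis using mem_walk_imp_edge[of Q] no_P by blast
    qed
    have "P \<notin> set Ps" using disj[of P] ne by auto
    moreover have "mset (edges (walk_arcs P)) + mset_set F = mset_set E"
    proof -
      have "mset_set E = mset_set (set (edges (walk_arcs P)) \<union> F)"
        using P(4) by (simp add: F_def Un_absorb1)
      also have "\<dots> = mset_set (set (edges (walk_arcs P))) + mset_set F"
        using psubset.hyps by (intro mset_set_Union) (auto simp: F_def)
      also have "mset_set (set (edges (walk_arcs P))) = mset (edges (walk_arcs P))"
        using P(3) by (rule mset_set_set)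
      finally show ?thesis by simp
    qed
    moreover have "\<forall>v\<in>set Q. \<forall>e\<in>E. v \<in> e \<longrightarrow> e \<in> set (edges (walk_arcs Q))" if "Q \<in> set Ps" for Q
    proof (intro ballI impI)
      fix v e assume v: "v \<in> set Q" "e \<in> E" "v \<in> e"
      then have "v \<notin> set P" using disj that by blast
      then have "e \<in> F" using v edge_subset_walk unfolding F_def by blast
      then show "e \<in> set (edges (walk_arcs Q))" using Ps(4) that v by blast
    qed
    moreover have "F \<subseteq> E" by (auto simp: F_def)
    ultimately show ?thesis
    proof (intro exI[of _ "P # Ps"] conjI)
      show "distinct (P # Ps)" using \<open>P \<notin> set Ps\<close> Ps(1) by simp
      show "\<forall>P'\<in>set (P # Ps). \<forall>Q\<in>set (P # Ps). P' \<noteq> Q \<longrightarrow> set P' \<inter> set Q = {}"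
        using Ps(2) disj by (auto simp: Int_commute)
      show "(\<Sum>P\<in>#mset (P # Ps). mset (edges (walk_arcs P))) = mset_set E"
        using Ps(3) \<open>mset (edges (walk_arcs P)) + mset_set F = mset_set E\<close> by simp
      show "\<forall>Q\<in>set (P # Ps). length Q \<ge> 2 \<and> hd Q = last Q \<and> distinct (edges (walk_arcs Q))
        \<and> set (edges (walk_arcs Q)) \<subseteq> E
        \<and> (\<forall>v\<in>set Q. \<forall>e\<in>E. v \<in> e \<longrightarrow> e \<in> set (edges (walk_arcs Q)))"
      proof
        fix Q assume "Q \<in> set (P # Ps)"
        then consider "Q = P" | "Q \<in> set Ps" by auto
        then show "length Q \<ge> 2 \<and> hd Q = last Q \<and> distinct (edges (walk_arcs Q))
        \<and> set (edges (walk_arcs Q)) \<subseteq> E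
        \<and> (\<forall>v\<in>set Q. \<forall>e\<in>E. v \<in> e \<longrightarrow> e \<in> set (edges (walk_arcs Q)))"
        proof cases
          case 1
          then show ?thesis using P by blast
        next
          case 2
          then show ?thesis using Ps(4) \<open>F \<subseteq> E\<close>
            \<open>\<And>Q. Q \<in> set Ps \<Longrightarrow> \<forall>v\<in>set Q. \<forall>e\<in>E. v \<in> e \<longrightarrow> e \<in> set (edges (walk_arcs Q))\<close> by blast
        qed
      qed
    qed
  qed
qed

section \<open>Splitting a closed trail into a cycle and a spanning rest\<close>

text \<open>Scanning from the right, the first entry that already occurs in the part read so far is
  \<open>y\<close>; that part is still distinct, so \<open>y # ys @ [y]\<close> closes a cycle
  without inner repetition.\<close>

lemma innermost_repetition:
  assumes "\<not> distinct vs"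
  shows "\<exists>xs y ys zs. vs = xs @ y # ys @ y # zs \<and> distinct (y # ys)"
  using assms
proof (induction vs)
  case (Cons v vs)
  show ?case
  proof (cases "distinct vs")
    case True
    with Cons.prems obtain ys zs where "vs = ys @ v # zs" by (auto dest: split_list)
    then have "v # vs = [] @ v # ys @ v # zs" "distinct (v # ys)" using True by auto
    then show ?thesis by blast
  next
    case False
    then obtain xs y ys zs where "vs = xs @ y # ys @ y # zs" "distinct (y # ys)" using Cons.IH by blast
    then have "v # vs = (v # xs) @ y # ys @ y # zs" by simp
    then show ?thesis using \<open>distinct (y # ys)\<close> by blast
  qed
qed simp

lemma count_list_distinct_le: "distinct xs \<Longrightarrow> count_list xs u \<le> 1"
  by (induction xs) (auto simp: count_notin)

text \<open>The cycle \<open>c1\<close> uses at most two edges at any vertex other than its base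
  point. With degree at least 4 there, some edge remains for \<open>c2\<close>, which therefore
  still visits every vertex.\<close>

lemma split_closed_trail:
  assumes len: "length P \<ge> 2" and closed: "hd P = last P" and dist: "distinct (edges (walk_arcs P))"
    and two: "\<forall>e\<in>set (edges (walk_arcs P)). card e = 2"
    and deg: "\<forall>v\<in>set P. length (filter (\<lambda>e. v \<in> e) (edges (walk_arcs P))) \<ge> 4"
  shows "\<exists>w x c1 c2. hd c1 = w \<and> last c1 = w \<and> x \<noteq> w \<and> (\<exists>xs zs. c1 = xs @ x # zs \<and> xs \<noteq> [] \<and> zs \<noteq> [])
    \<and> hd c2 = w \<and> last c2 = w \<and> length c2 \<ge> 2 \<and> set P \<subseteq> set c2
    \<and> w \<in> set P \<and> x \<in> set P \<and> set P - {w, x} \<noteq> {}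
    \<and> mset (edges (walk_arcs P)) = mset (edges (walk_arcs c1)) + mset (edges (walk_arcs c2))"
proof -
  have "\<not> distinct P" using len closed by (cases P) (auto split: if_splits)
  then obtain xs y ys zs where P: "P = xs @ y # ys @ y # zs" and d: "distinct (y # ys)"
    using innermost_repetition by blast
  define c1 where "c1 = y # ys @ [y]"
  \<comment> \<open>Deleting the cycle leaves the closed walk \<open>xs @ y # zs\<close>; this is
    its rotation to the base point \<open>y\<close>.\<close>
  define c2 where "c2 = (y # zs) @ tl (xs @ [y])"
  have "hd (xs @ y # zs) = last (xs @ y # zs)" using closed P by (cases xs) auto
  note rot = rotate_closed_walk[OF this refl c2_def]
  have "walk_arcs P = walk_arcs (xs @ [y]) @ walk_arcs (y # ys @ y # zs)"
    unfolding P by (rule walk_arcs_join)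
  also have "walk_arcs (y # ys @ y # zs) = walk_arcs c1 @ walk_arcs (y # zs)"
    using walk_arcs_join[of "y # ys" y zs] by (simp add: c1_def)
  finally have PE: "walk_arcs P = walk_arcs (xs @ [y]) @ walk_arcs c1 @ walk_arcs (y # zs)" .
  have E: "mset (edges (walk_arcs P)) = mset (edges (walk_arcs c1)) + mset (edges (walk_arcs c2))"
    using rot(1) by (simp add: PE)
  have c1E: "set (edges (walk_arcs c1)) \<subseteq> set (edges (walk_arcs P))" "distinct (edges (walk_arcs c1))"
    using dist by (auto simp: PE)
  obtain x ys' where ys: "ys = x # ys'"
  proof (cases ys)
    case Nil
    then have "{y, y} \<in> set (edges (walk_arcs P))" using c1E by (auto simp: c1_def edge_of_def)
    then show ?thesis using two by fastforce
  qed
  \<comment> \<open>With \<open>x\<close> alone inside the cycle, the edge between \<open>x\<close>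
    and \<open>y\<close> would occur twice on the trail. The third vertex found here keeps the set
    of reversal vertices for \<open>c2\<close> nonempty.\<close>
  have ys': "ys' \<noteq> []"
  proof
    assume "ys' = []"
    then show False using c1E(2) ys by (auto simp: c1_def edge_of_def)
  qed
  have xy: "x \<noteq> y" using d ys by auto
  have sub: "u \<in> set c2" if u: "u \<in> set P" "u \<noteq> y" for u
  proof -
    have "length (filter (\<lambda>e. u \<in> e) (edges (walk_arcs c1))) = count_list (y # ys) u + count_list (ys @ [y]) u"
    proof -
      have "butlast c1 = y # ys" "tl c1 = ys @ [y]" by (simp_all add: c1_def butlast_append)
      moreover have "\<forall>e\<in>set (edges (walk_arcs c1)). card e = 2" using c1E(1) two by blast
      ultimately show ?thesis using degree_walk[of c1 u] by simp
    qed
    also have "\<dots> \<le> 2" using count_list_distinct_le[of ys u] d u by simp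
    finally have "length (filter (\<lambda>e. u \<in> e) (edges (walk_arcs c1))) \<le> 2" .
    moreover have "length (filter (\<lambda>e. u \<in> e) (edges (walk_arcs P))) =
        length (filter (\<lambda>e. u \<in> e) (edges (walk_arcs c1))) + length (filter (\<lambda>e. u \<in> e) (edges (walk_arcs c2)))"
      using arg_cong[OF E, of "\<lambda>M. size (filter_mset (\<lambda>e. u \<in> e) M)"]
      by (metis filter_union_mset mset_filter size_mset size_union)
    moreover have "length (filter (\<lambda>e. u \<in> e) (edges (walk_arcs P))) \<ge> 4" using deg u by blast
    ultimately have "length (filter (\<lambda>e. u \<in> e) (edges (walk_arcs c2))) \<noteq> 0" by linarith
    then have "filter (\<lambda>e. u \<in> e) (edges (walk_arcs c2)) \<noteq> []" by (metis list.size(3))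
    then obtain e where "e \<in> set (edges (walk_arcs c2))" "u \<in> e"
      unfolding filter_empty_conv by blast
    then show ?thesis using edge_subset_walk by blast
  qed
  have "x \<in> set P" using P ys by simp
  then have "x \<in> set c2" using sub xy by blast
  then have "x \<in> set (zs @ tl (xs @ [y]))" using xy by (auto simp: c2_def)
  then have "length c2 \<ge> 2" by (cases "zs @ tl (xs @ [y])") (auto simp: c2_def)
  moreover have "set P \<subseteq> set c2" using sub by (auto simp: c2_def)
  moreover have "set P - {y, x} \<noteq> {}" using ys ys' d P by (cases ys') auto
  moreover have "hd c1 = y" "last c1 = y" by (simp_all add: c1_def)
  moreover have "\<exists>xs zs. c1 = xs @ x # zs \<and> xs \<noteq> [] \<and> zs \<noteq> []"
    by (rule exI[of _ "[y]"], rule exI[of _ "ys' @ [y]"]) (simp add: c1_def ys)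
  moreover have "y \<in> set P" using P by simp
  ultimately show ?thesis
    using E rot(3,4) xy \<open>x \<in> set P\<close>
    by - (rule exI[of _ y], rule exI[of _ x], rule exI[of _ c1], rule exI[of _ c2], intro conjI; assumption)
qed

section \<open>Assembling the two layers of labels\<close>

lemma distinct_excess_arrangement:
  assumes "finite E" and two: "\<forall>e\<in>E. card e = 2"
    and ev: "\<forall>v. even (card {e \<in> E. v \<in> e})" and deg: "\<forall>v\<in>\<Union>E. card {e \<in> E. v \<in> e} \<ge> 4"
  shows "\<exists>as. mset (edges as) = mset_set E \<and> inj_on (excess 0 as) (\<Union>E)"
proof -
  obtain Ps where Ps: "distinct Ps" "\<forall>P\<in>set Ps. \<forall>Q\<in>set Ps. P \<noteq> Q \<longrightarrow> set P \<inter> set Q = {}"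
    "(\<Sum>P\<in>#mset Ps. mset (edges (walk_arcs P))) = mset_set E"
    and tr: "\<forall>P\<in>set Ps. length P \<ge> 2 \<and> hd P = last P \<and> distinct (edges (walk_arcs P))
        \<and> set (edges (walk_arcs P)) \<subseteq> E
        \<and> (\<forall>v\<in>set P. \<forall>e\<in>E. v \<in> e \<longrightarrow> e \<in> set (edges (walk_arcs P)))"
    using closed_trail_decomposition[OF assms(1-3)] by blast
  have cover: "\<Union>E \<subseteq> (\<Union>P\<in>set Ps. set P)"
  proof
    fix v assume "v \<in> \<Union>E"
    then obtain e where e: "e \<in> E" "v \<in> e" by blast
    then have "e \<in># (\<Sum>P\<in>#mset Ps. mset (edges (walk_arcs P)))" using Ps(3) assms(1) by simp
    then obtain P where "P \<in> set Ps" "e \<in> set (edges (walk_arcs P))" by auto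
    then show "v \<in> (\<Union>P\<in>set Ps. set P)" using e edge_subset_walk by fastforce
  qed
  have "\<exists>w x c1 c2. hd c1 = w \<and> last c1 = w \<and> x \<noteq> w \<and> (\<exists>xs zs. c1 = xs @ x # zs \<and> xs \<noteq> [] \<and> zs \<noteq> [])
    \<and> hd c2 = w \<and> last c2 = w \<and> length c2 \<ge> 2 \<and> set P \<subseteq> set c2
    \<and> w \<in> set P \<and> x \<in> set P \<and> set P - {w, x} \<noteq> {}
    \<and> mset (edges (walk_arcs P)) = mset (edges (walk_arcs c1)) + mset (edges (walk_arcs c2))"
    if "P \<in> set Ps" for P
  proof (rule split_closed_trail)
    have P: "length P \<ge> 2" "hd P = last P" "distinct (edges (walk_arcs P))" "set (edges (walk_arcs P)) \<subseteq> E"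
      "\<forall>v\<in>set P. \<forall>e\<in>E. v \<in> e \<longrightarrow> e \<in> set (edges (walk_arcs P))"
      using tr that by blast+
    then show "length P \<ge> 2" "hd P = last P" "distinct (edges (walk_arcs P))"
      "\<forall>e\<in>set (edges (walk_arcs P)). card e = 2"
      using two by blast+
    show "\<forall>v\<in>set P. 4 \<le> length (filter (\<lambda>e. v \<in> e) (edges (walk_arcs P)))"
    proof
      fix v assume v: "v \<in> set P"
      then have "v \<in> \<Union>E" using mem_walk_imp_edge[of P v] P by blast
      moreover have "{e \<in> E. v \<in> e} = {e. v \<in> e} \<inter> set (edges (walk_arcs P))" using P(4,5) v by blast
      ultimately show "4 \<le> length (filter (\<lambda>e. v \<in> e) (edges (walk_arcs P)))"
        using deg distinct_length_filter[OF P(3)] by metis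
    qed
  qed
  then have "\<forall>P\<in>set Ps. \<exists>w x c1 c2. hd c1 = w \<and> last c1 = w \<and> x \<noteq> w \<and> (\<exists>xs zs. c1 = xs @ x # zs \<and> xs \<noteq> [] \<and> zs \<noteq> [])
    \<and> hd c2 = w \<and> last c2 = w \<and> length c2 \<ge> 2 \<and> set P \<subseteq> set c2
    \<and> w \<in> set P \<and> x \<in> set P \<and> set P - {w, x} \<noteq> {}
    \<and> mset (edges (walk_arcs P)) = mset (edges (walk_arcs c1)) + mset (edges (walk_arcs c2))"
    by blast
  then obtain W X A B where split: "\<forall>P\<in>set Ps. hd (A P) = W P \<and> last (A P) = W P \<and> X P \<noteq> W P
    \<and> (\<exists>xs zs. A P = xs @ X P # zs \<and> xs \<noteq> [] \<and> zs \<noteq> [])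
    \<and> hd (B P) = W P \<and> last (B P) = W P \<and> length (B P) \<ge> 2 \<and> set P \<subseteq> set (B P)
    \<and> W P \<in> set P \<and> X P \<in> set P \<and> set P - {W P, X P} \<noteq> {}
    \<and> mset (edges (walk_arcs P)) = mset (edges (walk_arcs (A P))) + mset (edges (walk_arcs (B P)))"
    unfolding bchoice_iff by blast
  \<comment> \<open>Since \<open>X P\<close> is left out, the lower layer passes straight through it
    and gives it excess 0; its weight comes from the upper layer alone.\<close>
  define Y where "Y P = set P - {W P, X P}" for P
  have WY: "insert (W P) (Y P) \<subseteq> set P" "{W P, X P} \<subseteq> set P" if "P \<in> set Ps" for P
    using split that by (auto simp: Y_def)
  have "\<forall>P\<in>set Ps. length (B P) \<ge> 2 \<and> hd (B P) = W P \<and> last (B P) = W P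
      \<and> finite (Y P) \<and> Y P \<noteq> {} \<and> Y P \<subseteq> set (B P) \<and> W P \<notin> Y P"
  proof
    fix P assume "P \<in> set Ps"
    then have "length (B P) \<ge> 2" "hd (B P) = W P" "last (B P) = W P" "Y P \<noteq> {}" "Y P \<subseteq> set (B P)"
      using split unfolding Y_def by blast+
    then show "length (B P) \<ge> 2 \<and> hd (B P) = W P \<and> last (B P) = W P
      \<and> finite (Y P) \<and> Y P \<noteq> {} \<and> Y P \<subseteq> set (B P) \<and> W P \<notin> Y P"
      by (simp add: Y_def)
  qed
  moreover have "\<forall>P\<in>set Ps. \<forall>Q\<in>set Ps. P \<noteq> Q \<longrightarrow> insert (W P) (Y P) \<inter> insert (W Q) (Y Q) = {}"
  proof (intro ballI impI)
    fix P Q assume "P \<in> set Ps" "Q \<in> set Ps" "P \<noteq> Q"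
    then have "set P \<inter> set Q = {}" using Ps(2) by blast
    then show "insert (W P) (Y P) \<inter> insert (W Q) (Y Q) = {}"
      using WY(1)[OF \<open>P \<in> set Ps\<close>] WY(1)[OF \<open>Q \<in> set Ps\<close>] by blast
  qed
  ultimately obtain as where as: "mset (edges as) = (\<Sum>P\<in>#mset Ps. mset (edges (walk_arcs (B P))))"
    "inj_on (excess 0 as) (\<Union>P\<in>set Ps. Y P)"
    "\<forall>u\<in>(\<Union>P\<in>set Ps. Y P). 4 * int 0 + 2 < \<bar>excess 0 as u\<bar> \<and> \<bar>excess 0 as u\<bar> \<le> 4 * int (0 + length as) + 2"
    "\<forall>P\<in>set Ps. excess 0 as (W P) \<le> 0"
    "\<forall>u. u \<notin> (\<Union>P\<in>set Ps. insert (W P) (Y P)) \<longrightarrow> excess 0 as u = 0"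
    using stack_zigzags[OF Ps(1), of B W Y 0] by blast
  define k where "k = length as"
  \<comment> \<open>The cycles are stacked in order of decreasing lower excess at
    \<open>W P\<close>. The upper excess at \<open>W P\<close> strictly decreases along the same
    list, hence so does the sum.\<close>
  define Qs where "Qs = sort_key (\<lambda>P. - excess 0 as (W P)) Ps"
  have Qs: "mset Qs = mset Ps" "set Qs = set Ps" "distinct Qs" using Ps(1) by (simp_all add: Qs_def)
  have Q_sorted: "sorted_wrt (\<lambda>P Q. excess 0 as (W P) \<ge> excess 0 as (W Q)) Qs"
    using sorted_sort_key[of "\<lambda>P. - excess 0 as (W P)" Ps] by (simp add: Qs_def[symmetric] sorted_wrt_map)
  have "\<forall>P\<in>set Qs. hd (A P) = W P \<and> last (A P) = W P \<and> X P \<noteq> W P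
      \<and> (\<exists>xs zs. A P = xs @ X P # zs \<and> xs \<noteq> [] \<and> zs \<noteq> [])"
    unfolding Qs(2) using split by blast
  moreover have "\<forall>P\<in>set Qs. \<forall>Q\<in>set Qs. P \<noteq> Q \<longrightarrow> {W P, X P} \<inter> {W Q, X Q} = {}"
    unfolding Qs(2)
  proof (intro ballI impI)
    fix P Q assume "P \<in> set Ps" "Q \<in> set Ps" "P \<noteq> Q"
    then have "set P \<inter> set Q = {}" using Ps(2) by blast
    then show "{W P, X P} \<inter> {W Q, X Q} = {}"
      using WY(2)[OF \<open>P \<in> set Ps\<close>] WY(2)[OF \<open>Q \<in> set Ps\<close>] by blast
  qed
  ultimately obtain bs where bs: "mset (edges bs) = (\<Sum>P\<in>#mset Qs. mset (edges (walk_arcs (A P))))"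
    "sorted_wrt (\<lambda>P Q. excess k bs (X P) < excess k bs (X Q)) Qs"
    "sorted_wrt (\<lambda>P Q. excess k bs (W P) > excess k bs (W Q)) Qs"
    "\<forall>P\<in>set Qs. excess k bs (X P) > 4 * int k + 2 \<and> excess k bs (W P) < - (4 * int k + 2)"
    "\<forall>u. u \<notin> (\<Union>P\<in>set Qs. {W P, X P}) \<longrightarrow> excess k bs u = 0"
    using stack_single_turns[OF Qs(3), of A W X k] by blast
  let ?f = "excess 0 (as @ bs)"
  have f: "?f u = excess 0 as u + excess k bs u" for u
    by (simp add: excess_append k_def)
  have own: "Q = P" if "P \<in> set Ps" "Q \<in> set Ps" "u \<in> set P" "u \<in> set Q" for P Q u
    using Ps(2) that by blast
  \<comment> \<open>Three separate ranges: vertices in \<open>Y P\<close> stay within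
    \<open>4 * k + 2\<close> in absolute value, each \<open>X P\<close> lies above and each
    \<open>W P\<close> below. Only vertices of the same kind then need a finer comparison.\<close>
  have fY: "?f u = excess 0 as u" "\<bar>?f u\<bar> \<le> 4 * int k + 2" if P: "P \<in> set Ps" and u: "u \<in> Y P" for P u
  proof -
    have "u \<notin> {W Q, X Q}" if "Q \<in> set Ps" for Q
    proof
      assume "u \<in> {W Q, X Q}"
      moreover from this have "Q = P" using own[OF P that, of u] WY(2)[OF that] u by (auto simp: Y_def)
      ultimately show False using u by (auto simp: Y_def)
    qed
    then have "u \<notin> (\<Union>P\<in>set Qs. {W P, X P})" unfolding Qs(2) by blast
    then have "excess k bs u = 0" using bs(5) by blast
    then show "?f u = excess 0 as u" using f by simp
    then show "\<bar>?f u\<bar> \<le> 4 * int k + 2" using as(3) P u by (simp add: k_def)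
  qed
  have fX: "?f (X P) = excess k bs (X P)" "?f (X P) > 4 * int k + 2" if P: "P \<in> set Ps" for P
  proof -
    have "X P \<notin> insert (W Q) (Y Q)" if "Q \<in> set Ps" for Q
    proof
      assume a: "X P \<in> insert (W Q) (Y Q)"
      then have "Q = P" using own[OF P that, of "X P"] WY(1)[OF that] WY(2)[OF P] by blast
      then show False using a split P by (auto simp: Y_def)
    qed
    then have "X P \<notin> (\<Union>P\<in>set Ps. insert (W P) (Y P))" by blast
    then have "excess 0 as (X P) = 0" using as(5) by blast
    then show "?f (X P) = excess k bs (X P)" using f by simp
    then show "?f (X P) > 4 * int k + 2" using bs(4) P Qs(2) by simp
  qed
  have fW: "?f (W P) < - (4 * int k + 2)" if "P \<in> set Ps" for P
    using as(4) bs(4) that f[of "W P"] Qs(2) by fastforce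
  have X_sorted: "sorted_wrt (\<lambda>P Q. ?f (X P) < ?f (X Q)) Qs"
    by (rule sorted_wrt_mono_rel[OF _ bs(2)]) (simp add: fX(1) Qs(2))
  have W_sorted: "sorted_wrt (\<lambda>P Q. ?f (W P) > ?f (W Q)) Qs"
    using bs(3) Q_sorted unfolding sorted_wrt_iff_nth_less f by (simp add: add_le_less_mono)
  have sorted_inj: "P = Q" if "sorted_wrt R Qs" "P \<in> set Ps" "Q \<in> set Ps" "\<not> R P Q" "\<not> R Q P" for P Q R
    using that unfolding Qs(2)[symmetric] sorted_wrt_iff_nth_less in_set_conv_nth by (metis linorder_neqE_nat)
  have kinds: "(\<exists>P\<in>set Ps. u \<in> Y P) \<or> (\<exists>P\<in>set Ps. u = X P) \<or> (\<exists>P\<in>set Ps. u = W P)" if "u \<in> \<Union>E" for u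
    using cover that unfolding Y_def by blast
  have "inj_on ?f (\<Union>E)"
  proof (rule inj_onI)
    fix u v assume uv: "u \<in> \<Union>E" "v \<in> \<Union>E" and eq: "?f u = ?f v"
    from kinds[OF uv(1)] kinds[OF uv(2)] show "u = v"
    proof (elim disjE bexE)
      fix P Q assume a: "P \<in> set Ps" "u \<in> Y P" "Q \<in> set Ps" "v \<in> Y Q"
      then have "excess 0 as u = excess 0 as v" using eq fY(1)[of P u] fY(1)[of Q v] by simp
      then show "u = v" using as(2) a by (auto dest: inj_onD)
    next
      fix P Q assume a: "P \<in> set Ps" "u = X P" "Q \<in> set Ps" "v = X Q"
      then show "u = v" using sorted_inj[OF X_sorted, of P Q] eq by simp
    next
      fix P Q assume a: "P \<in> set Ps" "u = W P" "Q \<in> set Ps" "v = W Q"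
      then show "u = v" using sorted_inj[OF W_sorted, of P Q] eq by simp
    next
      fix P Q assume "P \<in> set Ps" "u \<in> Y P" "Q \<in> set Ps" "v = X Q"
      then show "u = v" using fY(2)[of P u] fX(2)[of Q] eq by simp
    next
      fix P Q assume "P \<in> set Ps" "u \<in> Y P" "Q \<in> set Ps" "v = W Q"
      then show "u = v" using fY(2)[of P u] fW[of Q] eq by simp
    next
      fix P Q assume "P \<in> set Ps" "u = X P" "Q \<in> set Ps" "v \<in> Y Q"
      then show "u = v" using fY(2)[of Q v] fX(2)[of P] eq by simp
    next
      fix P Q assume "P \<in> set Ps" "u = X P" "Q \<in> set Ps" "v = W Q"
      then show "u = v" using fW[of Q] fX(2)[of P] eq by simp
    next
      fix P Q assume "P \<in> set Ps" "u = W P" "Q \<in> set Ps" "v \<in> Y Q"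
      then show "u = v" using fY(2)[of Q v] fW[of P] eq by simp
    next
      fix P Q assume "P \<in> set Ps" "u = W P" "Q \<in> set Ps" "v = X Q"
      then show "u = v" using fW[of P] fX(2)[of Q] eq by simp
    qed
  qed
  moreover have "mset (edges (as @ bs)) = mset_set E"
  proof -
    have "mset (edges (as @ bs)) =
        (\<Sum>P\<in>#mset Ps. mset (edges (walk_arcs (A P))) + mset (edges (walk_arcs (B P))))"
      using as(1) bs(1) by (simp add: Qs(1) sum_mset.distrib)
    also have "\<dots> = (\<Sum>P\<in>#mset Ps. mset (edges (walk_arcs P)))"
    proof (intro arg_cong[of _ _ sum_mset] image_mset_cong)
      fix P assume "P \<in># mset Ps"
      then show "mset (edges (walk_arcs (A P))) + mset (edges (walk_arcs (B P))) = mset (edges (walk_arcs P))"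
        using split by simp
    qed
    finally show ?thesis using Ps(3) by simp
  qed
  ultimately show ?thesis by blast
qed

section \<open>From excess back to vertex-sums, and the regular graph\<close>

lemma excess_eq_sum:
  assumes "distinct as" "\<And>i. i < length as \<Longrightarrow> c (as ! i) = Suc (k + i)"
  shows "excess k as u = (\<Sum>a\<in>set as. (if snd a = u then 2 * int (c a) + 1 else 0)
    - (if fst a = u then 2 * int (c a) - 1 else 0))"
  using assms
proof (induction as arbitrary: k)
  case (Cons a as)
  have "c a = Suc k" using Cons.prems(2)[of 0] by simp
  moreover have "c (as ! i) = Suc (Suc k + i)" if "i < length as" for i
    using Cons.prems(2)[of "Suc i"] that by simp
  ultimately show ?case using Cons.IH[of "Suc k"] Cons.prems(1) by simp
qed simp

text \<open>An entering label \<open>l\<close> counts \<open>2 * l + 1\<close> and a leaving one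
  \<open>- (2 * l - 1)\<close>: each arc adds 1 to twice its signed label, which yields the degree.
  When degrees are equal, distinct excesses thus mean distinct vertex-sums.\<close>

lemma excess_eq_vertex_sum:
  assumes D: "parcs D = set as" and "distinct as" and "\<And>i. i < length as \<Longrightarrow> c (as ! i) = Suc i"
  shows "excess 0 as u = 2 * vertex_sum (with_proj D) c u
    + int (card (in_arcs (with_proj D) u) + card (out_arcs (with_proj D) u))"
proof -
  have "excess 0 as u = (\<Sum>a\<in>set as. if snd a = u then 2 * int (c a) + 1 else 0)
      - (\<Sum>a\<in>set as. if fst a = u then 2 * int (c a) - 1 else 0)"
    using excess_eq_sum[of as c 0 u] assms by (simp add: sum_subtractf)
  also have "\<dots> = (\<Sum>a | a \<in> set as \<and> snd a = u. 2 * int (c a) + 1)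
      - (\<Sum>a | a \<in> set as \<and> fst a = u. 2 * int (c a) - 1)"
    by (simp add: sum.inter_filter)
  also have "\<dots> = 2 * vertex_sum (with_proj D) c u
      + int (card (in_arcs (with_proj D) u) + card (out_arcs (with_proj D) u))"
    by (simp add: vertex_sum_def in_arcs_def out_arcs_def D sum.distrib sum_subtractf sum_distrib_left)
  finally show ?thesis .
qed

theorem theorem1p5:
  fixes G :: "'a pair_pre_digraph" and d :: nat
  assumes "d \<ge> 2"
    and "pair_graph G"
    and "regular (2 * d) G"
  shows "admits_antimagic_orientation G"
proof -
  interpret pair_graph G by fact
  define E where "E = edge_of ` parcs G"
  have fin: "finite E" unfolding E_def using pair_finite_arcs by simp
  have two: "\<forall>e\<in>E. card e = 2"
    using pair_no_loops by (auto simp: E_def edge_of_def)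
  have arc_iff: "{u, v} \<in> E \<longleftrightarrow> (u, v) \<in> parcs G" for u v
    using arcs_symmetric by (auto simp: E_def edge_of_def doubleton_eq_iff image_iff Bex_def)
  \<comment> \<open>Both directions of an edge are arcs of \<open>G\<close>, so each edge at
    \<open>u\<close> comes from exactly one arc leaving \<open>u\<close>; the out-degree is the
    number of edges at \<open>u\<close>.\<close>
  have star: "card {e \<in> E. u \<in> e} = card {a \<in> parcs G. fst a = u}" for u
  proof -
    have "edge_of ` {a \<in> parcs G. fst a = u} = {e \<in> E. u \<in> e}"
    proof (intro equalityI subsetI)
      fix e assume "e \<in> {e \<in> E. u \<in> e}"
      then obtain v where v: "e = {u, v}" "e \<in> E" by (auto simp: E_def edge_of_def insert_commute)
      then have "(u, v) \<in> parcs G" using arc_iff by simp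
      then show "e \<in> edge_of ` {a \<in> parcs G. fst a = u}" using v(1) by (force simp: edge_of_def)
    qed (auto simp: E_def edge_of_def)
    moreover have "inj_on edge_of {a \<in> parcs G. fst a = u}"
      by (auto simp: inj_on_def edge_of_def doubleton_eq_iff)
    ultimately show ?thesis by (metis card_image)
  qed
  have star_verts: "card {e \<in> E. u \<in> e} = 2 * d" if "u \<in> pverts G" for u
    using assms(3) that by (simp add: star regular_def out_degree_def out_arcs_def)
  have UE: "\<Union>E = pverts G"
  proof (intro equalityI subsetI)
    fix u assume "u \<in> pverts G"
    then have "{e \<in> E. u \<in> e} \<noteq> {}" using star_verts[of u] assms(1) by (metis card.empty mult_eq_0_iff not_numeral_le_zero zero_neq_numeral)
    then show "u \<in> \<Union>E" by blast
  qed (use arc_fst_in_verts arc_snd_in_verts in \<open>force simp: E_def edge_of_def\<close>)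
  have "\<forall>v. even (card {e \<in> E. v \<in> e})"
  proof
    fix v show "even (card {e \<in> E. v \<in> e})"
    proof (cases "v \<in> pverts G")
      case False
      then have "{e \<in> E. v \<in> e} = {}" using UE by blast
      then show ?thesis by (metis card.empty even_zero)
    qed (simp add: star_verts)
  qed
  moreover have "\<forall>v\<in>\<Union>E. card {e \<in> E. v \<in> e} \<ge> 4" using UE star_verts assms(1) by simp
  ultimately obtain as where as: "mset (edges as) = mset_set E" and inj: "inj_on (excess 0 as) (pverts G)"
    using distinct_excess_arrangement[OF fin two] UE by auto
  have set_as: "set (edges as) = E" using as fin by (metis finite_set_mset_mset_set set_mset_mset)
  have dist: "distinct (edges as)"
    using as fin set_as by (metis card_distinct size_mset size_mset_set)
  then have dist_as: "distinct as" and inj_as: "inj_on edge_of (set as)" by (simp_all add: distinct_map)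
  define D where "D = \<lparr>pverts = pverts G, parcs = set as\<rparr>"
  have D: "pverts D = pverts G" "parcs D = set as" by (simp_all add: D_def)
  have sub: "set as \<subseteq> parcs G"
  proof
    fix a assume "a \<in> set as"
    then have "{fst a, snd a} \<in> E" using set_as by (auto simp: edge_of_def)
    then show "a \<in> parcs G" using arc_iff[of "fst a" "snd a"] by simp
  qed
  have "orientation_of D G"
    unfolding orientation_of_def D
  proof (intro conjI ballI)
    fix a assume a: "a \<in> parcs G"
    obtain u v where uv: "a = (u, v)" by force
    have "{u, v} \<in> set (edges as)" using a uv arc_iff set_as by simp
    then have "(u, v) \<in> set as \<or> (v, u) \<in> set as" by (auto simp: edge_of_def doubleton_eq_iff)
    \<comment> \<open>An edge present in both directions would occur twice in the distinct list
      \<open>edges as\<close>.\<close>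
    moreover have "\<not> ((u, v) \<in> set as \<and> (v, u) \<in> set as)"
    proof
      assume "(u, v) \<in> set as \<and> (v, u) \<in> set as"
      moreover have "edge_of (u, v) = edge_of (v, u)" by (simp add: edge_of_def insert_commute)
      ultimately have "(u, v) = (v, u)" using inj_onD[OF inj_as] by blast
      then have "u = v" by (rule Pair_inject)
      then show False using pair_no_loops[OF a] uv by simp
    qed
    ultimately show "case a of (u, v) \<Rightarrow> ((u, v) \<in> set as) \<noteq> ((v, u) \<in> set as)" using uv by simp blast
  qed (use sub in simp_all)
  moreover have "antimagic_labeling (with_proj D) c" if c: "\<And>i. i < length as \<Longrightarrow> c (as ! i) = Suc i" for c
    unfolding antimagic_labeling_def with_proj_simps D
  proof (intro conjI ballI impI)
    have "c ` set as = {1..card (set as)}"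
    proof -
      have "set as = (!) as ` {..<length as}"
        using nth_image[of "length as" as] by (simp add: lessThan_atLeast0)
      then have "c ` set as = (\<lambda>i. c (as ! i)) ` {..<length as}" by (simp only: image_image)
      also have "\<dots> = Suc ` {..<length as}" by (rule image_cong) (simp_all add: c)
      finally show ?thesis using dist_as by (simp add: distinct_card image_Suc_lessThan)
    qed
    moreover have "inj_on c (set as)"
    proof (rule inj_onI)
      fix a b assume "a \<in> set as" "b \<in> set as" "c a = c b"
      then show "a = b" using c by (metis in_set_conv_nth nat.inject)
    qed
    ultimately show "bij_betw c (set as) {1..card (set as)}" by (simp add: bij_betw_def)
  next
    \<comment> \<open>Here regularity enters: the degree term relating excess to vertex-sum is the
      same at all vertices.\<close>
    have deg: "card (in_arcs (with_proj D) u) + card (out_arcs (with_proj D) u) = 2 * d" if "u \<in> pverts G" for u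
    proof -
      have "in_arcs (with_proj D) u \<inter> out_arcs (with_proj D) u = {}"
        using sub pair_no_loops by (auto simp: in_arcs_def out_arcs_def D)
      then have "card (in_arcs (with_proj D) u) + card (out_arcs (with_proj D) u)
          = card (in_arcs (with_proj D) u \<union> out_arcs (with_proj D) u)"
        by (intro card_Un_disjoint[symmetric]) (auto simp: in_arcs_def out_arcs_def D)
      also have "\<dots> = card {a \<in> set as. u \<in> edge_of a}"
        by (intro arg_cong[of _ _ card]) (auto simp: in_arcs_def out_arcs_def D edge_of_def)
      also have "\<dots> = card (edge_of ` {a \<in> set as. u \<in> edge_of a})"
        using inj_as by (intro card_image[symmetric]) (auto simp: inj_on_def)
      also have "edge_of ` {a \<in> set as. u \<in> edge_of a} = {e \<in> E. u \<in> e}"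
        using set_as by auto
      finally show ?thesis using star_verts that by simp
    qed
    fix u v assume uv: "u \<in> pverts G" "v \<in> pverts G" "u \<noteq> v"
    then have "excess 0 as u \<noteq> excess 0 as v" using inj by (auto dest: inj_onD)
    then show "vertex_sum (with_proj D) c u \<noteq> vertex_sum (with_proj D) c v"
      using excess_eq_vertex_sum[OF D(2) dist_as c] deg uv by auto
  qed
  \<comment> \<open>The label of an arc is its position in \<open>as\<close>, counted from 1;
    distinctness of \<open>as\<close> makes the position unique.\<close>
  moreover have "\<exists>c. \<forall>i<length as. c (as ! i) = Suc i"
    using dist_as by (intro exI[of _ "\<lambda>a. Suc (THE i. i < length as \<and> as ! i = a)"])
      (auto simp: nth_eq_iff_index_eq intro!: the_equality)
  ultimately show ?thesis
    unfolding admits_antimagic_orientation_def antimagic_def by blast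
qed

end
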